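(* There does not exist a function $f_3:\mathbb{N}\to\mathbb{N}$ with $f_3(n)\to\infty$ as $n\to\infty$ such that, for every $n$, every $n$-vertex $4$-critical graph contains cycles whose lengths are $f_3(n)$ consecutive integers.
   Context: All graphs are finite and simple. The length of a cycle is its number of edges. A graph $G$ is $k$-critical if $\chi(G)=k$ and every proper subgraph of $G$ is $(k-1)$-colorable. A graph "contains cycles whose lengths are $m$ consecutive integers" if there is an integer $a$ such that the graph contains a cycle of length $\ell$ for each $\ell\in\{a,a+1,\ldots,a+m-1\}$. *)

theory Defs
  imports Complex_Main "Graph_Theory.Graph_Theory"
begin

text \<open>
  Graph_Theory represents undirected graphs as symmetric digraphs: \<^term>\<open>pair_graph\<close>
  describes the finite simple graphs, with each edge uv encoded as the two arcs (u,v) and (v,u).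
\<close>

definition colorable :: "nat \<Rightarrow> 'a pair_pre_digraph \<Rightarrow> bool" where
  "colorable k G \<longleftrightarrow>
     (\<exists>c :: 'a \<Rightarrow> nat. (\<forall>v \<in> pverts G. c v < k) \<and> (\<forall>(u, v) \<in> parcs G. c u \<noteq> c v))"

definition chromatic_number :: "'a pair_pre_digraph \<Rightarrow> nat" where
  "chromatic_number G = (LEAST k. colorable k G)"

text \<open>
  The library relation \<^const>\<open>subgraph\<close> is meant for digraphs, and also admits
  non-symmetric sub-digraphs; hence the extra requirement that H be a graph itself.
\<close>

definition critical :: "nat \<Rightarrow> 'a pair_pre_digraph \<Rightarrow> bool" where
  "critical k G \<longleftrightarrow> pair_graph G \<and> chromatic_number G = k \<and>
     (\<forall>H :: 'a pair_pre_digraph.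
        pair_graph H \<and> subgraph (with_proj H) (with_proj G) \<and> H \<noteq> G \<longrightarrow> colorable (k - 1) H)"

text \<open>
  A \<^const>\<open>pre_digraph.cycle\<close> is a nonempty list of arcs, so its length is its number of edges.
  The bound 3 excludes the closed walks u, v, u along a single edge, which count as cycles
  of a digraph but not of an undirected graph.
\<close>

definition has_cycle_of_length :: "'a pair_pre_digraph \<Rightarrow> int \<Rightarrow> bool" where
  "has_cycle_of_length G l \<longleftrightarrow>
     (\<exists>p. pre_digraph.cycle (with_proj G) p \<and> 3 \<le> length p \<and> int (length p) = l)"

definition has_consecutive_cycle_lengths :: "'a pair_pre_digraph \<Rightarrow> nat \<Rightarrow> bool" where
  "has_consecutive_cycle_lengths G m \<longleftrightarrow>
     (\<exists>a :: int. \<forall>l \<in> {a .. a + int m - 1}. has_cycle_of_length G l)"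

lemma colorable_card:
  assumes "pair_graph G"
  shows "colorable (card (pverts G)) G"
proof -
  interpret pair_graph G by fact
  obtain c where c: "bij_betw c (pverts G) {0..<card (pverts G)}"
    using ex_bij_betw_finite_nat[OF finite_verts] by blast
  have "c v < card (pverts G)" if "v \<in> pverts G" for v
    using bij_betwE[OF c] that by auto
  moreover have "c u \<noteq> c v" if "(u, v) \<in> parcs G" for u v
    using bij_betw_imp_inj_on[OF c] in_arcsD1[OF that] in_arcsD2[OF that] no_loops'[OF that]
    by (auto dest: inj_onD)
  ultimately show ?thesis
    unfolding colorable_def by blast
qed

lemma colorable_chromatic_number:
  assumes "pair_graph G"
  shows "colorable (chromatic_number G) G"
  unfolding chromatic_number_def using colorable_card[OF assms] by (rule LeastI)

end

theory Submission
  imports Defs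
begin

text \<open>
  Nest k + 1 copies of K4 minus an edge by Hajos joins: the i-th copy has terminals
  x = 3i, y = 3i + 1 and inner vertices b = 3i + 2 and x' = 3i + 3; its inner edge b x' is replaced
  by an edge from b to y' = 3i + 4, where x', y' are the terminals of the next copy, and the
  outermost terminals 0, 1 are joined. In a 3-coloring, x \<noteq> y forces b and x' to have equal colors
  and hence x' \<noteq> y', down to the innermost copy, where b and x' are adjacent.

  A path from x to y inside its copy has length 2 or passes through the next copy, gaining 3 edges
  on the path from x' to y' there. So its length is 2 modulo 3, unless it descends to the innermost
  inner edge. Hence a cycle of length 1 modulo 3 has length 4 or visits all 3k + 4 vertices, so
  that no nine consecutive integers are cycle lengths.
\<close>

section \<open>The nested graphs\<close>

text \<open>Edges point from the smaller to the larger vertex. The clause \<open>v = u + 2\<close>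
  is three kinds of edges in one: x b, y x' and b y', as \<open>u\<close> is 0, 1 or 2 modulo 3. The
  bound on \<open>v\<close> drops b y' in the innermost copy, which keeps its inner edge b x' by the
  clause \<open>v = 3 * k + 3\<close>.\<close>

definition strip_edge :: "nat \<Rightarrow> nat \<Rightarrow> nat \<Rightarrow> bool" where
  "strip_edge k u v \<longleftrightarrow> v \<le> 3 * k + 3 \<and>
     (v = u + 2 \<or> v = u + 3 \<and> u mod 3 = 0 \<or>
      v = u + 1 \<and> (u mod 3 = 1 \<or> u = 0 \<or> v = 3 * k + 3))"

definition strip_adj :: "nat \<Rightarrow> nat \<Rightarrow> nat \<Rightarrow> bool" where
  "strip_adj k u v \<longleftrightarrow> strip_edge k u v \<or> strip_edge k v u"

definition strip :: "nat \<Rightarrow> nat pair_pre_digraph" where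
  "strip k = \<lparr>pverts = {..3 * k + 3}, parcs = {(u, v). strip_adj k u v}\<rparr>"

lemma strip_simps [simp]:
  "pverts (strip k) = {..3 * k + 3}" "parcs (strip k) = {(u, v). strip_adj k u v}"
  by (simp_all add: strip_def)

lemma strip_adj_sym: "strip_adj k u v \<longleftrightarrow> strip_adj k v u"
  by (auto simp: strip_adj_def)

lemma strip_adj_le: "strip_adj k u v \<Longrightarrow> u \<le> 3 * k + 3 \<and> v \<le> 3 * k + 3"
  by (auto simp: strip_adj_def strip_edge_def)

lemma pair_graph_strip: "pair_graph (strip k)"
proof
  show "finite (parcs (strip k))"
    by (rule finite_subset[of _ "{..3 * k + 3} \<times> {..3 * k + 3}"]) (auto dest: strip_adj_le)
  show "symmetric (strip k)"
    by (auto simp: symmetric_def strip_adj_sym[of k] intro!: symI)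
qed (auto dest: strip_adj_le simp: strip_adj_def strip_edge_def)

subsection \<open>Criticality\<close>

lemma not_3_colorable_strip: "\<not> colorable 3 (strip k)"
proof
  assume "colorable 3 (strip k)"
  then obtain c :: "nat \<Rightarrow> nat" where c3: "\<And>v. v \<le> 3 * k + 3 \<Longrightarrow> c v < 3"
    and adj: "\<And>u v. strip_adj k u v \<Longrightarrow> c u \<noteq> c v"
    unfolding colorable_def by (auto simp: Ball_def)
  \<comment> \<open>The terminals of copy i use up two of the three colors, which leaves a single
    color for their common neighbours 3i + 2 and 3i + 3.\<close>
  have step: "c (3 * i + 2) = c (3 * i + 3)"
    if "i \<le> k" "c (3 * i) \<noteq> c (3 * i + 1)" for i
  proof -
    have "c (3 * i) \<noteq> c (3 * i + 2)" "c (3 * i) \<noteq> c (3 * i + 3)"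
      "c (3 * i + 1) \<noteq> c (3 * i + 2)" "c (3 * i + 1) \<noteq> c (3 * i + 3)"
      using \<open>i \<le> k\<close> by (auto intro!: adj simp: strip_adj_def strip_edge_def)
    moreover have "c (3 * i) < 3" "c (3 * i + 1) < 3" "c (3 * i + 2) < 3" "c (3 * i + 3) < 3"
      using \<open>i \<le> k\<close> by (auto intro!: c3)
    ultimately show ?thesis
      using that(2) by linarith
  qed
  have ne: "c (3 * i) \<noteq> c (3 * i + 1)" if "i \<le> k" for i
    using that
  proof (induction i)
    case 0
    show ?case by (rule adj) (simp add: strip_adj_def strip_edge_def)
  next
    case (Suc i)
    then have "c (3 * i + 2) = c (3 * i + 3)"
      by (intro step) auto
    moreover have "c (3 * i + 2) \<noteq> c (3 * i + 4)"
      using Suc.prems by (intro adj) (auto simp: strip_adj_def strip_edge_def)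
    ultimately show ?case
      by (simp add: algebra_simps)
  qed
  have "c (3 * k + 2) \<noteq> c (3 * k + 3)"
    by (rule adj) (simp add: strip_adj_def strip_edge_def)
  with step[OF order_refl ne[OF order_refl]] show False by simp
qed

text \<open>
  Colors the strip minus an edge meeting copy i: the terminals of copies 0, ..., i receive distinct
  colors, those of later copies equal ones. Here 2i + \<beta> is the color of 3i + 2 and 2i + \<sigma>
  that of both terminals of copy i + 1, modulo 3.
\<close>
definition break_coloring :: "nat \<Rightarrow> nat \<Rightarrow> nat \<Rightarrow> nat \<Rightarrow> nat" where
  "break_coloring i \<beta> \<sigma> v =
     (if v < 3 * i + 2 then v - v div 3
      else if v = 3 * i + 2 then 2 * i + \<beta>
      else v div 3 + i + 2 + \<sigma> + (if v mod 3 = 2 then 2 else 0)) mod 3"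

lemma break_coloring_simps:
  "j \<le> i \<Longrightarrow> break_coloring i \<beta> \<sigma> (3 * j) = 2 * j mod 3"
  "j \<le> i \<Longrightarrow> break_coloring i \<beta> \<sigma> (3 * j + 1) = (2 * j + 1) mod 3"
  "j < i \<Longrightarrow> break_coloring i \<beta> \<sigma> (3 * j + 2) = (2 * j + 2) mod 3"
  "break_coloring i \<beta> \<sigma> (3 * i + 2) = (2 * i + \<beta>) mod 3"
  "i < j \<Longrightarrow> break_coloring i \<beta> \<sigma> (3 * j) = (j + i + 2 + \<sigma>) mod 3"
  "i < j \<Longrightarrow> break_coloring i \<beta> \<sigma> (3 * j + 1) = (j + i + 2 + \<sigma>) mod 3"
  "i < j \<Longrightarrow> break_coloring i \<beta> \<sigma> (3 * j + 2) = (j + i + 4 + \<sigma>) mod 3"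
proof -
  have "(3 * j + 1) mod 3 = 1" "(3 * j + 2) mod 3 = 2" "(3 * j + 1) div 3 = j" "(3 * j + 2) div 3 = j"
    by presburger+
  then show "j \<le> i \<Longrightarrow> break_coloring i \<beta> \<sigma> (3 * j) = 2 * j mod 3"
    "j \<le> i \<Longrightarrow> break_coloring i \<beta> \<sigma> (3 * j + 1) = (2 * j + 1) mod 3"
    "j < i \<Longrightarrow> break_coloring i \<beta> \<sigma> (3 * j + 2) = (2 * j + 2) mod 3"
    "break_coloring i \<beta> \<sigma> (3 * i + 2) = (2 * i + \<beta>) mod 3"
    "i < j \<Longrightarrow> break_coloring i \<beta> \<sigma> (3 * j) = (j + i + 2 + \<sigma>) mod 3"
    "i < j \<Longrightarrow> break_coloring i \<beta> \<sigma> (3 * j + 1) = (j + i + 2 + \<sigma>) mod 3"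
    "i < j \<Longrightarrow> break_coloring i \<beta> \<sigma> (3 * j + 2) = (j + i + 4 + \<sigma>) mod 3"
    unfolding break_coloring_def by (simp_all add: ac_simps)
qed

text \<open>The edges by role: the outermost edge, then x b, x x', y b, y x' of copy j, the link b
  y' to the next copy, and the inner edge b x' of the innermost copy.\<close>

lemma strip_edge_cases:
  assumes "strip_edge k u v"
  obtains "u = 0" "v = 1"
  | j where "j \<le> k" "u = 3 * j" "v = 3 * j + 2"
  | j where "j \<le> k" "u = 3 * j" "v = 3 * j + 3"
  | j where "j \<le> k" "u = 3 * j + 1" "v = 3 * j + 2"
  | j where "j \<le> k" "u = 3 * j + 1" "v = 3 * j + 3"
  | j where "j < k" "u = 3 * j + 2" "v = 3 * j + 4"
  | "u = 3 * k + 2" "v = 3 * k + 3"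
proof -
  define j where "j = u div 3"
  have "u = 3 * j \<or> u = 3 * j + 1 \<or> u = 3 * j + 2"
    unfolding j_def by presburger
  then show thesis
    using assms that unfolding strip_edge_def by auto presburger+
qed

text \<open>Integer subtraction cancels the symbolic copy indices of two colors, leaving a small
  number to be tested for divisibility by 3.\<close>

lemma mod_3_eq_iff: "m mod 3 = n mod 3 \<longleftrightarrow> (3::int) dvd int m - int n" for m n :: nat
  by presburger

text \<open>If the terminals of copy i have distinct colors, the conditions on its other edges
  cannot all be met with three colors, but any four of the five can. Beyond copy i both terminals of
  each copy may then share a color. Removing the edge 0 1 allows equal terminals from the start,
  which needs a separate coloring.\<close>

lemma strip_minus_edge_colorable:
  assumes "strip_edge k u v"
  obtains c :: "nat \<Rightarrow> nat" where "\<And>w. c w < 3"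
    "\<And>a b. strip_edge k a b \<Longrightarrow> (a, b) \<noteq> (u, v) \<Longrightarrow> c a \<noteq> c b"
proof -
  note coloringI = that
  \<comment> \<open>Relative to colors 0 and 1 of the terminals of copy i, \<open>\<beta>\<close> is
    the color of b and \<open>\<sigma>\<close> that of x', and of y' if there is a next copy. Each
    disjunction is one edge, monochromatic only if it is the removed one; the last is b y', or b x'
    in the innermost copy.\<close>
  have break: thesis
    if "i \<le> k" and "\<beta> < 3" "\<sigma> < 3"
      and "\<beta> \<noteq> 0 \<or> (u, v) = (3 * i, 3 * i + 2)"
      and "\<beta> \<noteq> 1 \<or> (u, v) = (3 * i + 1, 3 * i + 2)"
      and "\<sigma> \<noteq> 0 \<or> (u, v) = (3 * i, 3 * i + 3)"
      and "\<sigma> \<noteq> 1 \<or> (u, v) = (3 * i + 1, 3 * i + 3)"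
      and "\<beta> \<noteq> \<sigma> \<or> (u, v) = (3 * i + 2, if i = k then 3 * i + 3 else 3 * i + 4)"
    for i \<beta> \<sigma> :: nat
  proof (rule coloringI)
    show "break_coloring i \<beta> \<sigma> w < 3" for w
      by (simp add: break_coloring_def)
    fix a b
    assume "strip_edge k a b" and ne: "(a, b) \<noteq> (u, v)"
    have \<beta>: "\<beta> = 0 \<or> \<beta> = 1 \<or> \<beta> = 2" and \<sigma>: "\<sigma> = 0 \<or> \<sigma> = 1 \<or> \<sigma> = 2"
      using that(2,3) by auto
    note colors = break_coloring_simps mod_3_eq_iff
    from \<open>strip_edge k a b\<close> show "break_coloring i \<beta> \<sigma> a \<noteq> break_coloring i \<beta> \<sigma> b"
    proof (cases rule: strip_edge_cases)
      case 1
      then show ?thesis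
        using break_coloring_simps(1,2)[of 0] by simp
    next
      case (2 j)
      then have ab: "a = 3 * j" "b = 3 * j + 2" by simp_all
      have ne_i: "j \<noteq> i \<or> \<beta> \<noteq> 0"
        using 2 \<open>\<beta> \<noteq> 0 \<or> (u, v) = (3 * i, 3 * i + 2)\<close> ne by auto
      consider "j < i" | "j = i" | "i < j" by linarith
      then show ?thesis
        unfolding ab using ne_i \<beta> \<sigma>
        by cases (simp_all only: colors, auto simp: algebra_simps)
    next
      case (3 j)
      \<comment> \<open>The larger end is written with index j + 1 to match
        \<open>break_coloring_simps\<close>.\<close>
      then have ab: "a = 3 * j" "b = 3 * (j + 1)" by simp_all
      have ne_i: "j \<noteq> i \<or> \<sigma> \<noteq> 0"
        using 3 \<open>\<sigma> \<noteq> 0 \<or> (u, v) = (3 * i, 3 * i + 3)\<close> ne by auto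
      consider "j < i" | "j = i" | "i < j" by linarith
      then show ?thesis
        unfolding ab using ne_i \<beta> \<sigma>
        by cases (simp_all only: colors, auto simp: algebra_simps)
    next
      case (4 j)
      then have ab: "a = 3 * j + 1" "b = 3 * j + 2" by simp_all
      have ne_i: "j \<noteq> i \<or> \<beta> \<noteq> 1"
        using 4 \<open>\<beta> \<noteq> 1 \<or> (u, v) = (3 * i + 1, 3 * i + 2)\<close> ne by auto
      consider "j < i" | "j = i" | "i < j" by linarith
      then show ?thesis
        unfolding ab using ne_i \<beta> \<sigma>
        by cases (simp_all only: colors, auto simp: algebra_simps)
    next
      case (5 j)
      then have ab: "a = 3 * j + 1" "b = 3 * (j + 1)" by simp_all
      have ne_i: "j \<noteq> i \<or> \<sigma> \<noteq> 1"
        using 5 \<open>\<sigma> \<noteq> 1 \<or> (u, v) = (3 * i + 1, 3 * i + 3)\<close> ne by auto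
      consider "j < i" | "j = i" | "i < j" by linarith
      then show ?thesis
        unfolding ab using ne_i \<beta> \<sigma>
        by cases (simp_all only: colors, auto simp: algebra_simps)
    next
      case (6 j)
      then have ab: "a = 3 * j + 2" "b = 3 * (j + 1) + 1" by simp_all
      have ne_i: "j \<noteq> i \<or> \<beta> \<noteq> \<sigma>"
        using 6 \<open>\<beta> \<noteq> \<sigma> \<or> (u, v) = (3 * i + 2, if i = k then 3 * i + 3 else 3 * i + 4)\<close> ne by auto
      consider "j < i" | "j = i" | "i < j" by linarith
      then show ?thesis
        unfolding ab using ne_i \<beta> \<sigma>
        by cases (simp_all only: colors, auto simp: algebra_simps)
    next
      case 7
      then have ab: "a = 3 * k + 2" "b = 3 * (k + 1)" by simp_all
      have ne_i: "k \<noteq> i \<or> \<beta> \<noteq> \<sigma>"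
        using 7 \<open>\<beta> \<noteq> \<sigma> \<or> (u, v) = (3 * i + 2, if i = k then 3 * i + 3 else 3 * i + 4)\<close> ne by auto
      consider "k = i" | "i < k" using \<open>i \<le> k\<close> by linarith
      then show ?thesis
        unfolding ab using ne_i \<beta> \<sigma>
        by cases (simp_all only: colors, auto simp: algebra_simps)
    qed
  qed
  show thesis
    using assms
  proof (cases rule: strip_edge_cases)
    case 1
    \<comment> \<open>Both terminals of copy j get color j and its vertex b gets j + 2, modulo 3, so
      that b differs from the terminals of copy j + 1 as well.\<close>
    define c :: "nat \<Rightarrow> nat" where "c w = (w div 3 + (if w mod 3 = 2 then 2 else 0)) mod 3" for w
    have c: "c (3 * j) = j mod 3" "c (3 * j + 1) = j mod 3" "c (3 * j + 2) = (j + 2) mod 3" for j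
    proof -
      have "(3 * j + 1) mod 3 = 1" "(3 * j + 2) mod 3 = 2" "(3 * j + 1) div 3 = j" "(3 * j + 2) div 3 = j"
        by presburger+
      then show "c (3 * j) = j mod 3" "c (3 * j + 1) = j mod 3" "c (3 * j + 2) = (j + 2) mod 3"
        by (simp_all add: c_def)
    qed
    show thesis
    proof (rule coloringI[of c])
      fix a b
      assume "strip_edge k a b" and ne: "(a, b) \<noteq> (u, v)"
      have c': "c (3 * j + 3) = (j + 1) mod 3" "c (3 * j + 4) = (j + 1) mod 3" for j
        using c(1,2)[of "j + 1"] by (simp_all add: algebra_simps)
      from \<open>strip_edge k a b\<close> show "c a \<noteq> c b"
        by (cases rule: strip_edge_cases)
          (use 1 ne in simp, simp_all only: c c' mod_3_eq_iff, simp_all)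
    qed (simp add: c_def)
  next
    \<comment> \<open>In this and the following cases, the chosen pair violates only the condition
      that belongs to the removed edge.\<close>
    case (2 j) then show thesis by (intro break[of j 0 2]) auto
  next
    case (3 j) then show thesis by (intro break[of j 2 0]) auto
  next
    case (4 j) then show thesis by (intro break[of j 1 2]) auto
  next
    case (5 j) then show thesis by (intro break[of j 2 1]) auto
  next
    case (6 j) then show thesis by (intro break[of j 2 2]) auto
  next
    case 7 then show thesis by (intro break[of k 2 2]) auto
  qed
qed

text \<open>With no isolated vertices, a proper subgraph must miss an edge and not merely a vertex.
  A neighbour lies at distance 2, upwards for 0 and 1 and downwards for all others.\<close>

lemma strip_covered: "v \<le> 3 * k + 3 \<Longrightarrow> \<exists>u. strip_adj k v u"
proof -
  assume "v \<le> 3 * k + 3"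
  then have "strip_edge k v (v + 2) \<or> strip_edge k (v - 2) v"
    by (cases "v < 2") (auto simp: strip_edge_def)
  then show ?thesis
    unfolding strip_adj_def by blast
qed

lemma critical_strip: "critical 4 (strip k)"
proof -
  have sub: "colorable 3 H"
    if "pair_graph H" "subgraph (with_proj H) (with_proj (strip k))" "H \<noteq> strip k"
    for H :: "nat pair_pre_digraph"
  proof -
    interpret H: pair_graph H by fact
    have V: "pverts H \<subseteq> {..3 * k + 3}" and A: "parcs H \<subseteq> {(u, v). strip_adj k u v}"
      using that(2) by (auto simp: subgraph_def)
    have sym: "(a, b) \<in> parcs H \<longleftrightarrow> (b, a) \<in> parcs H" for a b
      using H.sym_arcs by (auto simp: symmetric_def dest: symD)
    have "\<exists>a b. strip_adj k a b \<and> (a, b) \<notin> parcs H"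
    proof (rule ccontr)
      assume *: "\<not> ?thesis"
      then have "parcs H = parcs (strip k)" using A by auto
      moreover have "pverts H = pverts (strip k)"
        using V * strip_covered[of _ k] H.in_arcsD1 by fastforce
      ultimately show False
        using \<open>H \<noteq> strip k\<close> by simp
    qed
    then obtain u v where uv: "strip_edge k u v" "(u, v) \<notin> parcs H" "(v, u) \<notin> parcs H"
      unfolding strip_adj_def using sym by blast
    then obtain c :: "nat \<Rightarrow> nat" where c: "\<And>w. c w < 3"
      "\<And>a b. strip_edge k a b \<Longrightarrow> (a, b) \<noteq> (u, v) \<Longrightarrow> c a \<noteq> c b"
      by (metis strip_minus_edge_colorable)
    have "c a \<noteq> c b" if "(a, b) \<in> parcs H" for a b
    proof -
      have "strip_edge k a b \<or> strip_edge k b a"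
        using that A by (auto simp: strip_adj_def)
      moreover have "(a, b) \<noteq> (u, v)" "(b, a) \<noteq> (u, v)"
        using that uv(2,3) by auto
      ultimately show ?thesis
        using c(2)[of a b] c(2)[of b a] by fastforce
    qed
    then show ?thesis
      unfolding colorable_def using c(1) by blast
  qed
  have "colorable 4 (strip k)"
  proof -
    obtain c :: "nat \<Rightarrow> nat" where c: "\<And>w. c w < 3"
      "\<And>a b. strip_edge k a b \<Longrightarrow> (a, b) \<noteq> (0, 1) \<Longrightarrow> c a \<noteq> c b"
      using strip_minus_edge_colorable[of k 0 1] by (auto simp: strip_edge_def)
    have "c w \<noteq> 3" for w
      using c(1)[of w] by simp
    \<comment> \<open>The only edge that \<open>c\<close> may fail on is 0 1; a fourth color at 0
      repairs it.\<close>
    then have "(c(0 := 3)) a \<noteq> (c(0 := 3)) b" if "strip_edge k a b" for a b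
      using that c(2)[OF that] by (auto simp: strip_edge_def)
    then have "(c(0 := 3)) a \<noteq> (c(0 := 3)) b" if "strip_adj k a b" for a b
      using that unfolding strip_adj_def by metis
    moreover have "(c(0 := 3)) w < 4" for w
      using c(1)[of w] by simp
    ultimately show ?thesis
      unfolding colorable_def strip_simps by blast
  qed
  moreover have "4 \<le> m" if "colorable m (strip k)" for m
  proof (rule ccontr)
    assume "\<not> 4 \<le> m"
    moreover obtain c :: "nat \<Rightarrow> nat" where "\<forall>v \<in> pverts (strip k). c v < m"
      "\<forall>(u, v) \<in> parcs (strip k). c u \<noteq> c v"
      using \<open>colorable m (strip k)\<close> unfolding colorable_def by blast
    ultimately have "colorable 3 (strip k)"
      unfolding colorable_def by (intro exI[of _ c]) fastforce
    then show False using not_3_colorable_strip by blast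
  qed
  ultimately have "chromatic_number (strip k) = 4"
    unfolding chromatic_number_def by (rule Least_equality)
  then show ?thesis
    unfolding critical_def using pair_graph_strip sub by simp
qed

subsection \<open>Cycle lengths\<close>

text \<open>Lists of vertices are easy to reverse, cut and rotate. Here \<open>length\<close> counts
  vertices, one more than the edges of the path; for a cycle, given as a path with adjacent ends, it
  is the number of edges.\<close>

definition vertex_path :: "('a \<Rightarrow> 'a \<Rightarrow> bool) \<Rightarrow> 'a list \<Rightarrow> bool" where
  "vertex_path E vs \<longleftrightarrow> vs \<noteq> [] \<and> distinct vs \<and> successively E vs"

lemma vertex_path_rev:
  assumes "\<And>a b. E a b \<longleftrightarrow> E b a"
  shows "vertex_path E (rev vs) \<longleftrightarrow> vertex_path E vs"
proof -
  have "(\<lambda>a b. E b a) = E" using assms by blast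
  then show ?thesis by (simp only: vertex_path_def successively_rev rev_is_Nil_conv distinct_rev)
qed

lemma vertex_path_append:
  "xs \<noteq> [] \<Longrightarrow> ys \<noteq> [] \<Longrightarrow> vertex_path E (xs @ ys) \<longleftrightarrow>
     vertex_path E xs \<and> vertex_path E ys \<and> set xs \<inter> set ys = {} \<and> E (last xs) (hd ys)"
  by (auto simp: vertex_path_def successively_append_iff)

lemma vertex_path_Cons:
  "vs \<noteq> [] \<Longrightarrow> vertex_path E (v # vs) \<longleftrightarrow> v \<notin> set vs \<and> vertex_path E vs \<and> E v (hd vs)"
  by (auto simp: vertex_path_def successively_Cons)

lemma vertex_path_snoc:
  "vs \<noteq> [] \<Longrightarrow> vertex_path E (vs @ [v]) \<longleftrightarrow> v \<notin> set vs \<and> vertex_path E vs \<and> E (last vs) v"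
  by (auto simp: vertex_path_def successively_append_iff)

lemma vertex_path_hd_eq_last: "vertex_path E vs \<Longrightarrow> hd vs = last vs \<Longrightarrow> length vs = 1"
  by (cases vs) (auto simp: vertex_path_def split: if_splits)

text \<open>The list is \<open>map snd p\<close>, the heads of the arcs. The base vertex occurs
  once, as the last head, so distinctness is exactly what \<open>cycle\<close> demands of the tail
  of the vertex list.\<close>

lemma cycle_vertex_list:
  assumes "pre_digraph.cycle (with_proj G) p"
  obtains vs where "length vs = length p" "vertex_path (\<lambda>a b. (a, b) \<in> parcs G) vs"
    "(last vs, hd vs) \<in> parcs G"
proof -
  obtain u where "pre_digraph.awalk (with_proj G) u p u" and "p \<noteq> []"
    and dist: "distinct (tl (pre_digraph.awalk_verts (with_proj G) u p))"
    using assms by (auto simp: pre_digraph.cycle_def)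
  then have p: "set p \<subseteq> parcs G" "pcas u p u"
    by (auto simp: pre_digraph.awalk_def cas_with_proj_eq)
  have verts: "pawalk_verts x q = x # map snd q" if "pcas x q y" for x y q
    using that by (induction q arbitrary: x) auto
  have walk: "successively (\<lambda>a b. (a, b) \<in> parcs G) (x # map snd q) \<and> last (x # map snd q) = y"
    if "pcas x q y" "set q \<subseteq> parcs G" for x y q
    using that by (induction q arbitrary: x) auto
  obtain e q where "p = e # q" using \<open>p \<noteq> []\<close> by (cases p) auto
  moreover from this have "successively (\<lambda>a b. (a, b) \<in> parcs G) (map snd p)" "last (map snd p) = u"
    using walk[of "snd e" q u] p by auto
  moreover have "(u, snd e) \<in> parcs G"
    using p \<open>p = e # q\<close> by (cases e) auto
  ultimately show thesis
    using dist verts[OF p(2)] p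
    by (intro that[of "map snd p"]) (auto simp: vertex_path_def awalk_verts_with_proj_eq)
qed

lemma vertex_path_rotate_to:
  assumes "vertex_path E vs" "E (last vs) (hd vs)" "m \<in> set vs" 
  obtains ws where "length ws = length vs" "set ws = set vs" "hd ws = m"
    "vertex_path E ws" "E (last ws) (hd ws)"
proof -
  obtain xs ys where vs: "vs = xs @ m # ys"
    using assms(3) by (meson split_list)
  show thesis
  proof (cases "xs = []")
    case True
    then show ?thesis using assms vs that[of vs] by simp
  next
    case False
    then show ?thesis
      using assms(1,2) vs by (intro that[of "m # ys @ xs"])
        (auto simp: vertex_path_def successively_append_iff successively_Cons split: if_splits)
  qed
qed



section \<open>Paths confined to a copy and those nested in it\<close>

lemma strip_adj_up:
  "strip_adj k (3 * i) w \<Longrightarrow> 3 * i < w \<Longrightarrow> w = 3 * i + 2 \<or> w = 3 * i + 3 \<or> i = 0 \<and> w = 1"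
  "strip_adj k (3 * i + 1) w \<Longrightarrow> 3 * i + 1 < w \<Longrightarrow> w = 3 * i + 2 \<or> w = 3 * i + 3"
  "strip_adj k (3 * i + 2) w \<Longrightarrow> 3 * i + 2 < w \<Longrightarrow> i < k \<and> w = 3 * i + 4 \<or> i = k \<and> w = 3 * k + 3"
proof -
  have edge: "strip_edge k u w" if "strip_adj k u w" "u < w" for u
    using that by (auto simp: strip_adj_def strip_edge_def)
  show "strip_adj k (3 * i) w \<Longrightarrow> 3 * i < w \<Longrightarrow> w = 3 * i + 2 \<or> w = 3 * i + 3 \<or> i = 0 \<and> w = 1"
    by (drule (1) edge, erule strip_edge_cases; presburger)
  show "strip_adj k (3 * i + 1) w \<Longrightarrow> 3 * i + 1 < w \<Longrightarrow> w = 3 * i + 2 \<or> w = 3 * i + 3"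
    by (drule (1) edge, erule strip_edge_cases; presburger)
  show "strip_adj k (3 * i + 2) w \<Longrightarrow> 3 * i + 2 < w \<Longrightarrow>
      i < k \<and> w = 3 * i + 4 \<or> i = k \<and> w = 3 * k + 3"
    by (drule (1) edge, erule strip_edge_cases; presburger)
qed

text \<open>Dropping the end b leaves the single vertex x' if i = k, and otherwise a path joining
  the terminals x' and y' of the next copy. The exceptional length counts all vertices from 3i + 2
  on. The bound for the next copy is a hypothesis so that the lemma can serve inside the induction
  for \<open>strip_rail\<close>.\<close>

lemma strip_rung_step:
  assumes rail: "\<And>ws. i < k \<Longrightarrow> vertex_path (strip_adj k) ws \<Longrightarrow> hd ws = 3 * i + 3 \<Longrightarrow>
      last ws = 3 * i + 4 \<Longrightarrow> set ws \<subseteq> {3 * i + 3..} \<Longrightarrow> 2 < length ws \<Longrightarrow>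
      length ws mod 3 = 0 \<or> length ws = 3 * (k - i) + 1"
    and "i \<le> k" "vertex_path (strip_adj k) ws" "{hd ws, last ws} = {3 * i + 2, 3 * i + 3}"
      "set ws \<subseteq> {3 * i + 2..}"
  shows "length ws mod 3 = 1 \<or> length ws = 3 * (k - i) + 2"
proof -
  have oriented: "length ws mod 3 = 1 \<or> length ws = 3 * (k - i) + 2"
    if ws: "vertex_path (strip_adj k) ws" "hd ws = 3 * i + 3" "last ws = 3 * i + 2"
      "set ws \<subseteq> {3 * i + 2..}" for ws
  proof -
    define xs where "xs = butlast ws"
    have ws_eq: "ws = xs @ [3 * i + 2]"
      using ws(1,3) unfolding xs_def vertex_path_def by (metis append_butlast_last_id)
    then have "xs \<noteq> []" using ws(2) by auto
    then have xs: "vertex_path (strip_adj k) xs" "3 * i + 2 \<notin> set xs"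
      "strip_adj k (last xs) (3 * i + 2)" "hd xs = 3 * i + 3"
      using ws(1,2) ws_eq by (auto simp: vertex_path_snoc)
    have ge: "set xs \<subseteq> {3 * i + 3..}"
    proof
      fix x assume "x \<in> set xs"
      then have "x \<noteq> 3 * i + 2" "3 * i + 2 \<le> x" using xs(2) ws(4) ws_eq by auto
      then show "x \<in> {3 * i + 3..}" by simp
    qed
    have "3 * i + 2 < last xs"
      using ge last_in_set[OF \<open>xs \<noteq> []\<close>] by auto
    then consider "i < k" "last xs = 3 * i + 4" | "i = k" "last xs = 3 * k + 3"
      using strip_adj_up(3) xs(3) strip_adj_sym by blast
    then show ?thesis
    proof cases
      case 1
      \<comment> \<open>The terminals of copy i + 1 are not adjacent: among terminal pairs only 0
        and 1 are.\<close>
      have "2 < length xs"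
      proof (rule ccontr)
        assume "\<not> 2 < length xs"
        then have "xs = [3 * i + 3, 3 * i + 4]"
          using \<open>xs \<noteq> []\<close> xs(4) 1 by (cases xs; cases "tl xs") auto
        then have "strip_adj k (3 * (i + 1)) (3 * i + 4)"
          using xs(1) by (simp add: vertex_path_def add.commute)
        from strip_adj_up(1)[OF this] show False by simp
      qed
      from rail[OF 1(1) xs(1,4) 1(2) ge this] show ?thesis
        unfolding ws_eq using 1(1) by (auto simp: mod_Suc)
    next
      case 2
      then have "length xs = 1"
        using vertex_path_hd_eq_last[OF xs(1)] xs(4) by simp
      with 2 ws_eq show ?thesis by simp
    qed
  qed
  have "ws \<noteq> []" using assms(3) by (simp add: vertex_path_def)
  consider "hd ws = 3 * i + 3" "last ws = 3 * i + 2" | "hd ws = 3 * i + 2" "last ws = 3 * i + 3"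
    using assms(4) by (auto simp: doubleton_eq_iff)
  then show ?thesis
  proof cases
    case 1
    then show ?thesis using oriented assms(3,5) by blast
  next
    case 2
    then show ?thesis
      using oriented[of "rev ws"] assms(3,5) \<open>ws \<noteq> []\<close>
      by (simp add: vertex_path_rev[OF strip_adj_sym] hd_rev last_rev)
  qed
qed

text \<open>Without its ends x and y the path is a single vertex, giving three vertices in all, or a
  path joining b and x', which \<open>strip_rung_step\<close> reduces to the next copy. The bound
  \<open>2 < length ws\<close> excludes the edge 0 1. The exceptional length counts all vertices
  from 3i on.\<close>

lemma strip_rail:
  assumes "i \<le> k" "vertex_path (strip_adj k) ws" "hd ws = 3 * i" "last ws = 3 * i + 1"
    "set ws \<subseteq> {3 * i..}" "2 < length ws"
  shows "length ws mod 3 = 0 \<or> length ws = 3 * (k - i) + 4"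
  using assms
proof (induction "k - i" arbitrary: i ws rule: less_induct)
  case less
  obtain zs where ws_eq: "ws = 3 * i # zs @ [3 * i + 1]" and "zs \<noteq> []"
  proof -
    obtain a ys where "ws = a # ys" using less.prems(6) by (cases ws) auto
    moreover from this less.prems(6) have "ys \<noteq> []" by auto
    ultimately show thesis
      using less.prems(3,4,6) that[of "butlast ys"] append_butlast_last_id[of ys]
      by (cases "butlast ys") auto
  qed
  have zs: "vertex_path (strip_adj k) zs" "3 * i \<notin> set zs" "3 * i + 1 \<notin> set zs"
    "strip_adj k (3 * i) (hd zs)" "strip_adj k (3 * i + 1) (last zs)"
    using less.prems(2) \<open>zs \<noteq> []\<close> strip_adj_sym[of k "last zs"]
    unfolding ws_eq by (auto simp: vertex_path_Cons vertex_path_snoc)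
  have ge: "set zs \<subseteq> {3 * i + 2..}"
  proof
    fix x assume "x \<in> set zs"
    then have "x \<noteq> 3 * i" "x \<noteq> 3 * i + 1" "3 * i \<le> x" using zs(2,3) less.prems(5) ws_eq by auto
    then show "x \<in> {3 * i + 2..}" by simp
  qed
  have "3 * i + 2 \<le> hd zs" "3 * i + 2 \<le> last zs"
    using ge hd_in_set[OF \<open>zs \<noteq> []\<close>] last_in_set[OF \<open>zs \<noteq> []\<close>] by auto
  then have ends: "hd zs = 3 * i + 2 \<or> hd zs = 3 * i + 3" "last zs = 3 * i + 2 \<or> last zs = 3 * i + 3"
    using strip_adj_up(1)[OF zs(4)] strip_adj_up(2)[OF zs(5)] by auto
  show ?case
  proof (cases "hd zs = last zs")
    case True
    then show ?thesis
      using vertex_path_hd_eq_last[OF zs(1)] ws_eq by simp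
  next
    case False
    have "length zs mod 3 = 1 \<or> length zs = 3 * (k - i) + 2"
    proof (rule strip_rung_step[OF _ less.prems(1) zs(1) _ ge])
      show "{hd zs, last zs} = {3 * i + 2, 3 * i + 3}"
        using False ends by auto
    next
      fix vs
      assume "i < k" "vertex_path (strip_adj k) vs" "hd vs = 3 * i + 3" "last vs = 3 * i + 4"
        "set vs \<subseteq> {3 * i + 3..}" "2 < length vs"
      moreover from \<open>i < k\<close> have "k - i = Suc (k - (i + 1))"
        by auto
      ultimately show "length vs mod 3 = 0 \<or> length vs = 3 * (k - i) + 1"
        using less.hyps[of "i + 1" vs] by (simp add: add.commute)
    qed
    then show ?thesis
      using ws_eq by (auto simp: mod_Suc)
  qed
qed

lemma strip_rung:
  assumes "i \<le> k" "vertex_path (strip_adj k) ws" "{hd ws, last ws} = {3 * i + 2, 3 * i + 3}"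
    "set ws \<subseteq> {3 * i + 2..}"
  shows "length ws mod 3 = 1 \<or> length ws = 3 * (k - i) + 2"
proof (rule strip_rung_step[OF _ assms])
  fix vs
  assume "i < k" "vertex_path (strip_adj k) vs" "hd vs = 3 * i + 3" "last vs = 3 * i + 4"
    "set vs \<subseteq> {3 * i + 3..}" "2 < length vs"
  moreover from \<open>i < k\<close> have "k - i = Suc (k - (i + 1))"
    by auto
  ultimately show "length vs mod 3 = 0 \<or> length vs = 3 * (k - i) + 1"
    using strip_rail[of "i + 1" k vs] by (simp add: add.commute)
qed

section \<open>Lengths of cycles\<close>

text \<open>Cut the cycle at its smallest vertex \<open>m\<close>: the rest is a path above
  \<open>m\<close> whose distinct ends are larger neighbours of \<open>m\<close>, and there are few
  of those.\<close>

lemma strip_cycle_length: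
  assumes "vertex_path (strip_adj k) vs" "strip_adj k (last vs) (hd vs)" "3 \<le> length vs"
    "length vs mod 3 = 1"
  shows "length vs = 4 \<or> length vs = 3 * k + 4"
proof -
  define m where "m = Min (set vs)"
  have "vs \<noteq> []" using assms(1) by (simp add: vertex_path_def)
  then have "m \<in> set vs" unfolding m_def by simp
  then obtain us where us: "length us = length vs" "set us = set vs" "hd us = m"
    "vertex_path (strip_adj k) us" "strip_adj k (last us) m"
    using vertex_path_rotate_to[OF assms(1,2)] by metis
  obtain ws where us_eq: "us = m # ws" and "ws \<noteq> []"
    using us(1,3) assms(3) by (cases us) fastforce+
  have ws: "vertex_path (strip_adj k) ws" "m \<notin> set ws" "strip_adj k m (hd ws)" "strip_adj k m (last ws)"
    using us(4,5) \<open>ws \<noteq> []\<close> strip_adj_sym[of k m] unfolding us_eq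
    by (auto simp: vertex_path_Cons)
  have len: "length vs = length ws + 1" using us(1) us_eq by simp
  have gt: "set ws \<subseteq> {m<..}"
  proof
    fix x assume "x \<in> set ws"
    then have "x \<noteq> m" "x \<in> set vs" using ws(2) us(2) us_eq by auto
    then show "x \<in> {m<..}" unfolding m_def by (simp add: order_less_le)
  qed
  have up: "m < hd ws" "m < last ws"
    using gt hd_in_set[OF \<open>ws \<noteq> []\<close>] last_in_set[OF \<open>ws \<noteq> []\<close>] by auto
  have "hd ws \<noteq> last ws"
    using vertex_path_hd_eq_last[OF ws(1)] len assms(3) by auto
  have le: "hd ws \<le> 3 * k + 3" "last ws \<le> 3 * k + 3"
    using ws(3,4) by (auto dest: strip_adj_le)
  define i where "i = m div 3"
  consider "m = 3 * i" | "m = 3 * i + 1" | "m = 3 * i + 2"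
    unfolding i_def by linarith
  then show ?thesis
  proof cases
    \<comment> \<open>A vertex 3i + 2 has only one larger neighbour, too few for two distinct
      ends.\<close>
    case 3
    then show ?thesis
      using strip_adj_up(3)[of k i "hd ws"] strip_adj_up(3)[of k i "last ws"] ws(3,4) up \<open>hd ws \<noteq> last ws\<close>
      by auto
  next
    case 2
    then have "{hd ws, last ws} = {3 * i + 2, 3 * i + 3}"
      using strip_adj_up(2)[of k i "hd ws"] strip_adj_up(2)[of k i "last ws"] ws(3,4) up \<open>hd ws \<noteq> last ws\<close>
      by auto
    moreover have "set ws \<subseteq> {3 * i + 2..}" "i \<le> k" using gt 2 up le by auto
    ultimately have "length ws mod 3 = 1 \<or> length ws = 3 * (k - i) + 2"
      using strip_rung ws(1) by blast
    \<comment> \<open>Adding \<open>m\<close> gives a cycle length of 2 or 0 modulo 3, against the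
      assumption.\<close>
    then show ?thesis
      using assms(4) len by (auto simp: mod_Suc)
  next
    case 1
    have "i \<le> k" using 1 up le by auto
    have ends: "hd ws = 3 * i + 2 \<or> hd ws = 3 * i + 3 \<or> i = 0 \<and> hd ws = 1"
      "last ws = 3 * i + 2 \<or> last ws = 3 * i + 3 \<or> i = 0 \<and> last ws = 1"
      using strip_adj_up(1)[of k i "hd ws"] strip_adj_up(1)[of k i "last ws"] ws(3,4) up 1 by auto
    show ?thesis
    proof (cases "i = 0 \<and> (hd ws = 1 \<or> last ws = 1)")
      case True
      \<comment> \<open>The cycle uses the edge 0 1. Read in a suitable direction, it is a path from
        0 to 1.\<close>
      have "length vs mod 3 = 0 \<or> length vs = 3 * (k - 0) + 4"
      proof (cases "last ws = 1")
        case last: True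
        then show ?thesis
          using strip_rail[of 0 k us] us(1,3,4) us_eq True 1 assms(3) \<open>ws \<noteq> []\<close> by auto
      next
        case False
        then have "vertex_path (strip_adj k) (0 # rev ws)" "hd ws = 1"
          using us(4,5) us_eq True 1 \<open>ws \<noteq> []\<close>
          by (auto simp: vertex_path_Cons vertex_path_rev[OF strip_adj_sym] hd_rev strip_adj_sym)
        then show ?thesis
          using strip_rail[of 0 k "0 # rev ws"] len assms(3) \<open>ws \<noteq> []\<close> by (auto simp: last_rev)
      qed
      then show ?thesis using assms(4) by auto
    next
      case False
      then have ends': "{hd ws, last ws} = {3 * i + 2, 3 * i + 3}"
        using ends \<open>hd ws \<noteq> last ws\<close> by auto
      show ?thesis
      proof (cases "3 * i + 1 \<in> set ws")
        case True
        \<comment> \<open>Cutting at y leaves two disjoint paths with all four ends among b and x'.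
          Each is therefore a single vertex, and the cycle is x, b, y, x' up to direction.\<close>
        then obtain xs ys where ws_eq: "ws = xs @ (3 * i + 1) # ys"
          by (meson split_list)
        have "hd ws \<noteq> 3 * i + 1" "last ws \<noteq> 3 * i + 1"
          using ends' by (auto simp: doubleton_eq_iff)
        then have "xs \<noteq> []" "ys \<noteq> []"
          using ws_eq by auto
        then have parts: "vertex_path (strip_adj k) xs" "vertex_path (strip_adj k) ys"
          "set xs \<inter> set ys = {}" "3 * i + 1 \<notin> set xs" "3 * i + 1 \<notin> set ys"
          "strip_adj k (3 * i + 1) (last xs)" "strip_adj k (3 * i + 1) (hd ys)"
          "hd ws = hd xs" "last ws = last ys"
          using ws(1) strip_adj_sym[of k "last xs"] unfolding ws_eq
          by (auto simp: vertex_path_append vertex_path_Cons)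
        have "3 * i + 1 < x" if "x \<in> set xs \<union> set ys" for x
        proof -
          have "3 * i < x" "x \<noteq> 3 * i + 1"
            using that gt 1 parts(4,5) unfolding ws_eq by auto
          then show ?thesis by simp
        qed
        then have "3 * i + 1 < last xs" "3 * i + 1 < hd ys"
          using \<open>xs \<noteq> []\<close> \<open>ys \<noteq> []\<close> by auto
        then have "last xs = 3 * i + 2 \<or> last xs = 3 * i + 3" "hd ys = 3 * i + 2 \<or> hd ys = 3 * i + 3"
          using strip_adj_up(2) parts(6,7) by blast+
        moreover have "hd xs \<noteq> hd ys" "last xs \<noteq> last ys"
          using parts(3) \<open>xs \<noteq> []\<close> \<open>ys \<noteq> []\<close> by (metis disjoint_iff hd_in_set last_in_set)+
        ultimately have "hd xs = last xs" "hd ys = last ys"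
          using ends' parts(8,9) by (auto simp: doubleton_eq_iff)
        then have "length xs = 1" "length ys = 1"
          using vertex_path_hd_eq_last parts(1,2) by blast+
        then show ?thesis using len ws_eq by simp
      next
        case False
        have "set ws \<subseteq> {3 * i + 2..}"
        proof
          fix x assume "x \<in> set ws"
          then have "3 * i < x" "x \<noteq> 3 * i + 1" using gt 1 False by auto
          then show "x \<in> {3 * i + 2..}" by simp
        qed
        then have "length ws mod 3 = 1 \<or> length ws = 3 * (k - i) + 2"
          using strip_rung ws(1) ends' \<open>i \<le> k\<close> by blast
        then show ?thesis
          using assms(4) len by (auto simp: mod_Suc)
      qed
    qed
  qed
qed

lemma strip_cycle_lengths:
  assumes "has_cycle_of_length (strip k) l" "l mod 3 = 1"
  shows "l = 4 \<or> l = 3 * int k + 4"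
proof -
  obtain p where p: "pre_digraph.cycle (with_proj (strip k)) p" "3 \<le> length p" "int (length p) = l"
    using assms(1) unfolding has_cycle_of_length_def by blast
  obtain vs where vs: "length vs = length p" "vertex_path (strip_adj k) vs" "strip_adj k (last vs) (hd vs)"
    using cycle_vertex_list[OF p(1)] by auto
  have "length vs mod 3 = 1"
    using assms(2) p(3) vs(1) by presburger
  then show ?thesis
    using strip_cycle_length[OF vs(2,3)] p(2,3) vs(1) by auto
qed

lemma strip_no_nine_consecutive:
  assumes "has_consecutive_cycle_lengths (strip k) m"
  shows "m < 9"
proof (rule ccontr)
  assume "\<not> m < 9"
  moreover obtain a where a: "\<forall>l \<in> {a .. a + int m - 1}. has_cycle_of_length (strip k) l"
    using assms unfolding has_consecutive_cycle_lengths_def by blast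
  \<comment> \<open>The numbers b, b + 3 and b + 6 lie among the nine from a to a + 8 and are 1
    modulo 3, but only two such cycle lengths are possible.\<close>
  moreover obtain b where "a \<le> b" "b \<le> a + 2" "b mod 3 = 1"
  proof -
    have "\<exists>b. a \<le> b \<and> b \<le> a + 2 \<and> b mod 3 = 1"
      by presburger
    then show thesis using that by blast
  qed
  ultimately have "b + 3 * j = 4 \<or> b + 3 * j = 3 * int k + 4" if "j \<in> {0, 1, 2}" for j
    using that by (intro strip_cycle_lengths a[rule_format]) auto
  from this[of 0] this[of 1] this[of 2] show False
    by auto
qed

theorem theorem1p2:
  shows "\<not> (\<exists>f\<^sub>3 :: nat \<Rightarrow> nat. filterlim f\<^sub>3 at_top at_top \<and>
           (\<forall>n. \<forall>G :: nat pair_pre_digraph.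
              critical 4 G \<and> card (pverts G) = n \<longrightarrow> has_consecutive_cycle_lengths G (f\<^sub>3 n)))"
proof
  assume "\<exists>f\<^sub>3 :: nat \<Rightarrow> nat. filterlim f\<^sub>3 at_top at_top \<and>
           (\<forall>n. \<forall>G :: nat pair_pre_digraph.
              critical 4 G \<and> card (pverts G) = n \<longrightarrow> has_consecutive_cycle_lengths G (f\<^sub>3 n))"
  then obtain f :: "nat \<Rightarrow> nat" where "filterlim f at_top at_top"
    and f: "\<And>G :: nat pair_pre_digraph. critical 4 G \<Longrightarrow> has_consecutive_cycle_lengths G (f (card (pverts G)))"
    by blast
  then obtain N where "\<And>n. N \<le> n \<Longrightarrow> 9 \<le> f n"
    unfolding filterlim_at_top eventually_at_top_linorder by meson
  \<comment> \<open>The graph \<open>strip N\<close> has 3N + 4 vertices, hence at least N.\<close>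
  then have "9 \<le> f (card (pverts (strip N)))"
    by simp
  with strip_no_nine_consecutive[OF f[OF critical_strip]] show False
    by (simp add: not_less[symmetric])
qed

end
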